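(* Let $\Delta$ be a simplicial complex on the finite vertex set $S$. Then the complex $\Gamma(\Delta)$ of injective words derived from $\Delta$ is partitionable.
   Context: A simplicial complex on $S$ is a family of subsets of $S$ containing $\emptyset$ and closed under taking subsets (not necessarily pure). An injective word over $S$ is a word $w=\omega_1\cdots\omega_r$ ($r\ge 0$, the empty word included) with pairwise distinct letters in $S$; its content is $c(w)=\{\omega_1,\dots,\omega_r\}$. A subword of $w$ is $\omega_{j_1}\cdots\omega_{j_s}$ with $1\le j_1<\cdots<j_s\le r$. $\Gamma(\Delta)$ is the set of all injective words $w$ over $S$ with $c(w)\in\Delta$, ordered by $v\preceq w$ if $v$ is a subword of $w$; it is the face poset (including the empty face) of a Boolean cell complex, i.e. a regular CW-complex in which the face poset of each cell is a Boolean lattice, and is identified with it. A cell complex $\Gamma$ is partitionable if (its face poset, including the empty face) admits a partition into pairwise disjoint intervals $[\sigma_i,\tau_i]=\{\rho:\sigma_i\preceq\rho\preceq\tau_i\}$ such that each $\tau_i$ is a maximal cell of $\Gamma$. *)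

theory Defs
  imports "HOL-Library.Sublist" "HOL-Library.Disjoint_Sets"
begin

(* Not necessarily pure; elements of S need not be vertices of \<Delta>. *)
definition simplicial_complex_on :: "'a set \<Rightarrow> 'a set set \<Rightarrow> bool" where
  "simplicial_complex_on S \<Delta> \<longleftrightarrow>
     \<Delta> \<subseteq> Pow S \<and> {} \<in> \<Delta> \<and> (\<forall>F\<in>\<Delta>. \<forall>G. G \<subseteq> F \<longrightarrow> G \<in> \<Delta>)"

definition injective_words :: "'a set \<Rightarrow> 'a list set" where
  "injective_words S = {w. distinct w \<and> set w \<subseteq> S}"

(* The cells of \<Gamma>(\<Delta>), including the empty cell []. The complex is identified with its face
   poset, i.e. this set ordered by the subword relation subseq (subwords need not be contiguous). *)
definition injective_word_complex :: "'a set \<Rightarrow> 'a set set \<Rightarrow> 'a list set" where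
  "injective_word_complex S \<Delta> = {w \<in> injective_words S. set w \<in> \<Delta>}"

definition poset_interval :: "'c set \<Rightarrow> ('c \<Rightarrow> 'c \<Rightarrow> bool) \<Rightarrow> 'c \<Rightarrow> 'c \<Rightarrow> 'c set" where
  "poset_interval C le s t = {r \<in> C. le s r \<and> le r t}"

definition maximal_cell :: "'c set \<Rightarrow> ('c \<Rightarrow> 'c \<Rightarrow> bool) \<Rightarrow> 'c \<Rightarrow> bool" where
  "maximal_cell C le t \<longleftrightarrow> t \<in> C \<and> (\<forall>r\<in>C. le t r \<longrightarrow> r = t)"

(* C with the order le is the face poset of the complex, including the empty face.
   The intervals are nonempty by partition_on. *)
definition partitionable :: "'c set \<Rightarrow> ('c \<Rightarrow> 'c \<Rightarrow> bool) \<Rightarrow> bool" where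
  "partitionable C le \<longleftrightarrow>
     (\<exists>P. partition_on C P \<and>
          (\<forall>I\<in>P. \<exists>s\<in>C. \<exists>t. maximal_cell C le t \<and> I = poset_interval C le s t))"

end

theory Submission
  imports Defs
begin

text \<open>
  Cells are sorted by prefixes. If \<open>p @ u\<close> is maximal, then the cells with prefix \<open>p\<close>
  consist of the interval \<open>[p, p @ u]\<close> and a remainder. For every \<open>u\<close>, maximal or not, the remainder
  splits by the letter \<open>a\<close> that follows \<open>p\<close>: it contributes all cells with prefix \<open>p @ [a]\<close>
  if \<open>a\<close> is not in \<open>u\<close>, and if \<open>u = x @ a # y\<close> it contributes those outside
  \<open>[p @ [a], p @ a # y]\<close>, which is again a remainder. Downward induction on the length of \<open>p\<close>
  partitions everything.
\<close>

text \<open>Only the part \<open>X\<close> to be covered varies. Intervals and maximality still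
  refer to all of \<open>C\<close>, so decompositions of disjoint parts combine to one of
  \<open>C\<close>.\<close>

definition interval_decomposable :: "'c set \<Rightarrow> ('c \<Rightarrow> 'c \<Rightarrow> bool) \<Rightarrow> 'c set \<Rightarrow> bool" where
  "interval_decomposable C le X \<longleftrightarrow>
     (\<exists>P. partition_on X P \<and>
          (\<forall>I\<in>P. \<exists>s\<in>C. \<exists>t. maximal_cell C le t \<and> I = poset_interval C le s t))"

lemma partitionable_iff_interval_decomposable:
  "partitionable C le \<longleftrightarrow> interval_decomposable C le C"
  unfolding partitionable_def interval_decomposable_def ..

lemma interval_decomposable_UN:
  assumes dec: "\<And>a. a \<in> A \<Longrightarrow> interval_decomposable C le (X a)"
    and disj: "disjoint_family_on X A"
  shows "interval_decomposable C le (\<Union>a\<in>A. X a)"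
proof -
  from dec obtain P where P: "\<And>a. a \<in> A \<Longrightarrow> partition_on (X a) (P a)"
    and iv: "\<And>a. a \<in> A \<Longrightarrow> \<forall>I\<in>P a. \<exists>s\<in>C. \<exists>t. maximal_cell C le t \<and> I = poset_interval C le s t"
    unfolding interval_decomposable_def by metis
  have sub: "I \<subseteq> X a" if "a \<in> A" "I \<in> P a" for a I
    using P[OF that(1)] that(2) by (auto simp: partition_on_def)
  have "partition_on (\<Union>a\<in>A. X a) (\<Union>a\<in>A. P a)"
  proof (rule partition_onI)
    show "\<Union> (\<Union>a\<in>A. P a) = (\<Union>a\<in>A. X a)"
      using P by (fastforce simp: partition_on_def)
  next
    fix I J assume "I \<in> (\<Union>a\<in>A. P a)" "J \<in> (\<Union>a\<in>A. P a)" and ne: "I \<noteq> J"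
    then obtain a b where a: "a \<in> A" "I \<in> P a" and b: "b \<in> A" "J \<in> P b" by blast
    show "disjnt I J"
    proof (cases "a = b")
      case True
      then show ?thesis
        using P[OF a(1)] a b ne by (auto simp: partition_on_def disjoint_def disjnt_def)
    next
      case False
      then have "X a \<inter> X b = {}" using disj a b by (auto simp: disjoint_family_on_def)
      then show ?thesis using sub[OF a] sub[OF b] by (auto simp: disjnt_def)
    qed
  next
    show "{} \<notin> (\<Union>a\<in>A. P a)" using P by (auto simp: partition_on_def)
  qed
  then show ?thesis unfolding interval_decomposable_def using iv by blast
qed

lemma interval_decomposable_Un:
  assumes "interval_decomposable C le X" "interval_decomposable C le Y" "X \<inter> Y = {}"
  shows "interval_decomposable C le (X \<union> Y)"
proof -
  have "interval_decomposable C le (\<Union>b\<in>UNIV. if b then X else Y)"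
    using assms by (intro interval_decomposable_UN) (auto simp: disjoint_family_on_def)
  then show ?thesis by (simp add: UNIV_bool Un_commute)
qed

lemma interval_decomposable_interval:
  assumes "s \<in> C" "maximal_cell C le t" "poset_interval C le s t \<noteq> {}"
  shows "interval_decomposable C le (poset_interval C le s t)"
  unfolding interval_decomposable_def
  using assms by (intro exI[of _ "{poset_interval C le s t}"]) (auto intro: partition_on_space)

lemma subseq_imp_set_subset: "subseq xs ys \<Longrightarrow> set xs \<subseteq> set ys"
  by (induction rule: list_emb.induct) auto

lemma distinct_subseq: "subseq xs ys \<Longrightarrow> distinct ys \<Longrightarrow> distinct xs"
  by (induction rule: list_emb.induct) (auto dest: subseq_imp_set_subset)

text \<open>Split \<open>r\<close> along \<open>p @ u\<close>, then split \<open>p\<close> along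
  \<open>r\<close>. The second part of \<open>p\<close> embeds in \<open>u\<close>, so distinctness
  of \<open>p @ u\<close> makes it empty. Thus \<open>p\<close> is squeezed onto the first part of
  \<open>r\<close>.\<close>

lemma subseq_between_append:
  assumes "distinct (p @ u)" "subseq p r" "subseq r (p @ u)"
  obtains v where "r = p @ v" "subseq v u"
proof -
  from assms(3) obtain r1 r2 where r: "r = r1 @ r2" "subseq r1 p" "subseq r2 u"
    by (metis subseq_appendE)
  from assms(2) r(1) obtain p1 p2 where p: "p = p1 @ p2" "subseq p1 r1" "subseq p2 r2"
    by (metis subseq_appendE)
  have "set p2 \<subseteq> set u"
    using p(3) r(3) by (meson subseq_imp_set_subset subset_trans)
  then have "p2 = []" using assms(1) p(1) by (cases p2) auto
  then have "p = r1" using p r(2) by (simp add: subseq_order.antisym)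
  then show thesis using r that by blast
qed

text \<open>The first possible match for \<open>a\<close> is the displayed one, and matching as
  early as possible loses nothing.\<close>

lemma subseq_Cons_append_iff:
  "a \<notin> set xs \<Longrightarrow> subseq (a # v) (xs @ a # ys) \<longleftrightarrow> subseq v ys"
  by (induction xs) auto

text \<open>All that the partition argument needs. The bound \<open>N\<close> makes downward
  induction on prefix length terminate. A maximal cell above \<open>w\<close> must be reachable by
  appending letters at the end, so that the interval below it starting at \<open>w\<close> stays
  among the words with prefix \<open>w\<close>.\<close>

locale injective_word_family =
  fixes C :: "'a list set" and N :: nat
  assumes distinct_cell: "w \<in> C \<Longrightarrow> distinct w"
    and subseq_cell: "w \<in> C \<Longrightarrow> subseq v w \<Longrightarrow> v \<in> C"
    and length_cell: "w \<in> C \<Longrightarrow> length w \<le> N"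
    and extend_cell: "w \<in> C \<Longrightarrow> \<exists>u. maximal_cell C subseq (w @ u)"
begin

definition cells_with_prefix :: "'a list \<Rightarrow> 'a list set" where
  "cells_with_prefix p = {w \<in> C. prefix p w}"

definition prefixed_subwords :: "'a list \<Rightarrow> 'a list \<Rightarrow> 'a list set" where
  "prefixed_subwords p u = {p @ v | v. subseq v u}"

lemma interval_eq_prefixed_subwords:
  assumes "p @ u \<in> C"
  shows "poset_interval C subseq p (p @ u) = prefixed_subwords p u"
proof -
  have "p @ v \<in> C" if "subseq v u" for v
    using subseq_cell[OF assms] that by (simp add: subseq_append')
  moreover have "r \<in> prefixed_subwords p u" if "subseq p r" "subseq r (p @ u)" for r
    using subseq_between_append[OF distinct_cell[OF assms] that]
    by (auto simp: prefixed_subwords_def)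
  ultimately show ?thesis
    by (auto simp: poset_interval_def prefixed_subwords_def subseq_append' intro: prefix_imp_subseq)
qed

text \<open>The claim about remainders is a hypothesis here, so that this step serves both inside
  the induction that proves that claim and afterwards, for the empty prefix.\<close>

lemma decomposable_cells_with_prefix:
  assumes "p \<in> C"
    and rem: "\<And>u. p @ u \<in> C \<Longrightarrow>
      interval_decomposable C subseq (cells_with_prefix p - prefixed_subwords p u)"
  shows "interval_decomposable C subseq (cells_with_prefix p)"
proof -
  obtain u where max: "maximal_cell C subseq (p @ u)" using extend_cell[OF assms(1)] by blast
  then have C: "p @ u \<in> C" by (simp add: maximal_cell_def)
  have iv: "poset_interval C subseq p (p @ u) = prefixed_subwords p u"
    by (rule interval_eq_prefixed_subwords[OF C])
  have "p \<in> poset_interval C subseq p (p @ u)" using assms(1) by (simp add: poset_interval_def prefix_imp_subseq)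
  then have "interval_decomposable C subseq (prefixed_subwords p u)"
    using interval_decomposable_interval[OF assms(1) max] iv by auto
  then have "interval_decomposable C subseq
      (prefixed_subwords p u \<union> (cells_with_prefix p - prefixed_subwords p u))"
    using rem[OF C] by (rule interval_decomposable_Un) auto
  moreover have "prefixed_subwords p u \<subseteq> cells_with_prefix p"
    using subseq_cell[OF C]
    by (auto simp: cells_with_prefix_def prefixed_subwords_def subseq_append')
  ultimately show ?thesis by (simp add: Un_absorb1)
qed

text \<open>Maximality of \<open>p @ u\<close> cannot be demanded: the induction passes to
  \<open>p @ a # y\<close>, a proper subword of \<open>p @ x @ a # y\<close> whenever
  \<open>x\<close> is nonempty. No interval is split off here; that happens only where a letter
  outside \<open>u\<close> follows \<open>p\<close>.\<close>

lemma decomposable_remainder: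
  assumes "p @ u \<in> C"
  shows "interval_decomposable C subseq (cells_with_prefix p - prefixed_subwords p u)"
  using assms
proof (induction "N - length p" arbitrary: p u rule: less_induct)
  case less
  let ?A = "{a. p @ [a] \<in> C}"
  let ?X = "\<lambda>a. cells_with_prefix (p @ [a]) - prefixed_subwords p u"
  have "interval_decomposable C subseq (?X a)" if a: "p @ [a] \<in> C" for a
  proof -
    \<comment> \<open>The cell \<open>p @ [a]\<close> has length at most \<open>N\<close>, so
      \<open>length p < N\<close> and the truncated subtraction strictly decreases.\<close>
    have "N - length (p @ [a]) < N - length p" using length_cell[OF a] by auto
    note IH = less.hyps[OF this]
    show ?thesis
    proof (cases "a \<in> set u")
      case False
      \<comment> \<open>A word of \<open>prefixed_subwords p u\<close> continues \<open>p\<close>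
        only with letters of \<open>u\<close>, so nothing is removed.\<close>
      then have "?X a = cells_with_prefix (p @ [a])"
        by (auto simp: cells_with_prefix_def prefixed_subwords_def prefix_def
            dest: subseq_imp_set_subset)
      then show ?thesis using decomposable_cells_with_prefix[OF a IH] by simp
    next
      case True
      then obtain x y where u: "u = x @ a # y" "a \<notin> set x" by (meson split_list_first)
      have "subseq (p @ a # y) (p @ u)" by (simp add: u(1) subseq_append' list_emb_append2)
      then have "(p @ [a]) @ y \<in> C" using subseq_cell[OF less.prems] by simp
      moreover have "?X a = cells_with_prefix (p @ [a]) - prefixed_subwords (p @ [a]) y"
        using subseq_Cons_append_iff[OF u(2)]
        by (auto simp: u(1) cells_with_prefix_def prefixed_subwords_def prefix_def)
      ultimately show ?thesis using IH by simp
    qed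
  qed
  moreover have "disjoint_family_on ?X ?A"
    by (auto simp: disjoint_family_on_def cells_with_prefix_def prefix_def)
  ultimately have "interval_decomposable C subseq (\<Union>a\<in>?A. ?X a)"
    using interval_decomposable_UN[of ?A C subseq ?X] by blast
  moreover have "cells_with_prefix p - prefixed_subwords p u = (\<Union>a\<in>?A. ?X a)"
  proof (intro equalityI subsetI)
    fix w assume w: "w \<in> cells_with_prefix p - prefixed_subwords p u"
    then obtain v where v: "w = p @ v" "w \<in> C" by (auto simp: cells_with_prefix_def prefix_def)
    \<comment> \<open>The word \<open>p\<close> itself lies in \<open>prefixed_subwords p u\<close>,
      so \<open>w\<close> has a letter after \<open>p\<close>.\<close>
    with w obtain a v' where a: "v = a # v'" by (cases v) (auto simp: prefixed_subwords_def)
    have "subseq (p @ [a]) w" by (simp add: v(1) a subseq_append')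
    then have "p @ [a] \<in> C" using subseq_cell v(2) by blast
    then show "w \<in> (\<Union>a\<in>?A. ?X a)" using w v a by (auto simp: cells_with_prefix_def)
  qed (auto simp: cells_with_prefix_def prefix_def)
  ultimately show ?case by simp
qed

theorem partitionable_words: "partitionable C subseq"
proof (cases "[] \<in> C")
  case True
  have "cells_with_prefix [] = C" by (simp add: cells_with_prefix_def)
  then show ?thesis
    using decomposable_cells_with_prefix[OF True decomposable_remainder]
    by (simp add: partitionable_iff_interval_decomposable)
next
  case False
  \<comment> \<open>The locale permits an empty family, which the empty partition covers; any cell
    would have \<open>[]\<close> as a subword.\<close>
  then have "C = {}" using subseq_cell by (metis all_not_in_conv list_emb_Nil)
  then show ?thesis
    by (auto simp: partitionable_def partition_on_empty)
qed

end

text \<open>A cell above \<open>t\<close> has a face containing \<open>set t\<close> as its content,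
  hence the same content. Being injective, the two words have equal length, and a subword of full
  length is the whole word.\<close>

lemma maximal_cell_of_facet:
  assumes "distinct t" "set t \<in> \<Delta>" "\<Delta> \<subseteq> Pow S" "\<And>F. F \<in> \<Delta> \<Longrightarrow> set t \<subseteq> F \<Longrightarrow> F = set t"
  shows "maximal_cell (injective_word_complex S \<Delta>) subseq t"
  unfolding maximal_cell_def
proof (intro conjI ballI impI)
  show "t \<in> injective_word_complex S \<Delta>"
    using assms by (auto simp: injective_word_complex_def injective_words_def)
next
  fix r assume r: "r \<in> injective_word_complex S \<Delta>" and sub: "subseq t r"
  then have "distinct r" "set r \<in> \<Delta>"
    by (auto simp: injective_word_complex_def injective_words_def)
  moreover from this have "set r = set t" using assms(4) subseq_imp_set_subset[OF sub] by simp
  ultimately have "length r = length t" using assms(1) by (metis distinct_card)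
  then show "r = t" using sub by (metis subseq_same_length)
qed

lemma injective_word_family_complex:
  assumes fin: "finite S" and \<Delta>: "simplicial_complex_on S \<Delta>"
  shows "injective_word_family (injective_word_complex S \<Delta>) (card S)"
proof
  fix w assume w: "w \<in> injective_word_complex S \<Delta>"
  then have dw: "distinct w" "set w \<subseteq> S" "set w \<in> \<Delta>"
    by (auto simp: injective_word_complex_def injective_words_def)
  show "distinct w" by (fact dw)
  show "length w \<le> card S" using dw fin by (metis card_mono distinct_card)
  show "v \<in> injective_word_complex S \<Delta>" if v: "subseq v w" for v
  proof -
    have "set v \<in> \<Delta>"
      using \<Delta> dw(3) subseq_imp_set_subset[OF v] unfolding simplicial_complex_on_def by blast
    then show ?thesis
      using dw(2) distinct_subseq[OF v dw(1)] subseq_imp_set_subset[OF v]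
      unfolding injective_word_complex_def injective_words_def by blast
  qed
  have sub: "\<Delta> \<subseteq> Pow S" using \<Delta> by (simp add: simplicial_complex_on_def)
  then have "finite \<Delta>" using fin by (meson finite_Pow_iff finite_subset)
  \<comment> \<open>Choose a facet \<open>F\<close> containing the content of \<open>w\<close>;
    appending its missing letters in any order gives a maximal cell.\<close>
  then obtain F where F: "F \<in> \<Delta>" "set w \<subseteq> F" "\<And>G. G \<in> \<Delta> \<Longrightarrow> F \<subseteq> G \<Longrightarrow> G = F"
    using finite_has_maximal2[of \<Delta> "set w"] dw(3) by metis
  have "finite (F - set w)" using F(1) sub fin by (meson Pow_iff finite_Diff finite_subset subsetD)
  then obtain u where u: "set u = F - set w" "distinct u" using finite_distinct_list by metis
  have set: "set (w @ u) = F" using u F(2) by auto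
  have "maximal_cell (injective_word_complex S \<Delta>) subseq (w @ u)"
  proof (rule maximal_cell_of_facet)
    show "distinct (w @ u)" using dw u by auto
    show "set (w @ u) \<in> \<Delta>" unfolding set by (fact F(1))
    show "G = set (w @ u)" if "G \<in> \<Delta>" "set (w @ u) \<subseteq> G" for G
      using F(3) that unfolding set by blast
  qed (fact sub)
  then show "\<exists>u. maximal_cell (injective_word_complex S \<Delta>) subseq (w @ u)" ..
qed

theorem theorem1p4:
  fixes S :: "'a set" and \<Delta> :: "'a set set"
  assumes "finite S"
    and "simplicial_complex_on S \<Delta>"
  shows "partitionable (injective_word_complex S \<Delta>) subseq"
  using injective_word_family_complex[OF assms]
  by (rule injective_word_family.partitionable_words)

end
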